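(* Let $D\subset\mathbb{R}$ be open, let $f:D\to\mathbb{R}$ be a sufficiently smooth function in a neighborhood of a point $z\in D$, and suppose that $z$ is a simple zero of $f$. Let $t_0$ be Newton's map $$t_0(x)=x-[f^{(1)}(x)]^{-1}f(x).$$ For a given integer $m\ge 1$, define recursively, for $j=1,2,\ldots,m$, $$h_j(x)=t_{j-1}(x)-x,\qquad t_j(x)=x-[\phi_j(x)]^{-1}f(x),$$ where each $\phi_j$ is either the Taylor-type function of index $j$ or the barycentric-type function of index $j$, constructed from $f$ using $h_j$ as step function. Then the map $t_m$ has local order of convergence at least $m+2$ at $z$.
   Context: Notation: $f^{(i)}$ is the $i$-th derivative of $f$; $[\,\cdot\,]^{-1}$ denotes the reciprocal of a real value. A zero $z$ of $f$ is simple if $f(z)=0$ and $f^{(1)}(z)\neq 0$. "Sufficiently smooth" means having as many continuous derivatives near $z$ as needed (read it as $C^\infty$ in a neighborhood of $z$). All maps are considered in a sufficiently small neighborhood of $z$. Taylor-type function of index $j$ with step function $h$: $$\phi_j(x)=f^{(1)}(x)+\frac{f^{(2)}(x)}{2!}h(x)+\frac{f^{(3)}(x)}{3!}h(x)^2+\cdots+\frac{f^{(j+1)}(x)}{(j+1)!}h(x)^j .$$ Barycentric-type function of index $j$ with step function $h$: $$\phi_j(x)=\sum_{i=0}^{j}a_i\, f^{(1)}\bigl(x+i\,h(x)\bigr),$$ where $(a_0,\ldots,a_j)\in\mathbb{R}^{j+1}$ is the unique solution of the linear system $\sum_{i=0}^{j}(1-i)^r a_i=\frac{1}{r+1}$,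 $r=0,1,\ldots,j$ (with the convention $0^0=1$). Order of convergence: a map $t$ with $t(z)=z$ has order of convergence $p\ge 1$ at $z$ if $\lim_{x\to z}|z-t(x)|/|z-x|^p=c$ for some constant $c>0$. "Order of convergence at least $q$" means that there are a constant $C\geq 0$ and a neighborhood of $z$ on which $t$ is defined and $|t(x)-z|\le C|x-z|^{q}$. *)

theory Defs
  imports "HOL-Analysis.Analysis" "HOL-Computational_Algebra.Polynomial"
begin

text \<open>
  A real function on an open set \<open>D\<close> is a total function \<open>f :: real \<Rightarrow> real\<close> whose values
  outside \<open>D\<close> are irrelevant; \<open>(deriv ^^ k) f\<close> is its \<open>k\<close>-th derivative.
\<close>

definition smooth_near :: "real set \<Rightarrow> (real \<Rightarrow> real) \<Rightarrow> real \<Rightarrow> bool" where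
  "smooth_near D f z \<longleftrightarrow>
     (\<exists>U. open U \<and> z \<in> U \<and> U \<subseteq> D \<and>
        (\<forall>k. \<forall>x\<in>U. (deriv ^^ k) f field_differentiable (at x)))"

text \<open>
  Since \<open>deriv\<close> and division are total, the points at which an expression is really defined
  have to be tracked separately. \<open>nderiv_dom D f k\<close> is the domain of the \<open>k\<close>-th derivative
  of \<open>f : D \<rightarrow> \<real>\<close> for open \<open>D\<close>; differentiability at \<open>x\<close> is asked only where the preceding
  derivative exists on a whole neighbourhood of \<open>x\<close>.
\<close>

primrec nderiv_dom :: "real set \<Rightarrow> (real \<Rightarrow> real) \<Rightarrow> nat \<Rightarrow> real set" where
  "nderiv_dom D f 0 = D"
| "nderiv_dom D f (Suc k) =
     {x \<in> interior (nderiv_dom D f k). (deriv ^^ k) f field_differentiable (at x)}"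

definition taylor_phi :: "(real \<Rightarrow> real) \<Rightarrow> nat \<Rightarrow> (real \<Rightarrow> real) \<Rightarrow> real \<Rightarrow> real" where
  "taylor_phi f j h x = (\<Sum>i\<le>j. (deriv ^^ (i + 1)) f x / fact (i + 1) * h x ^ i)"

text \<open>
  A vector \<open>(a\<^sub>0, \<dots>, a\<^sub>j)\<close> is encoded as a function on \<open>nat\<close> that vanishes beyond \<open>j\<close>.
  The power at \<open>i = 1\<close>, \<open>r = 0\<close> is \<open>0 ^ 0 = 1\<close>, as in the convention for the linear system.
\<close>

definition bary_system :: "nat \<Rightarrow> (nat \<Rightarrow> real) \<Rightarrow> bool" where
  "bary_system j a \<longleftrightarrow>
     (\<forall>r\<le>j. (\<Sum>i\<le>j. (1 - real i) ^ r * a i) = 1 / (real r + 1)) \<and> (\<forall>i>j. a i = 0)"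

definition bary_coeff :: "nat \<Rightarrow> nat \<Rightarrow> real" where
  "bary_coeff j = (THE a. bary_system j a)"

lemma ex1_bary_system: "\<exists>!a. bary_system j a"
proof -
  define x :: "nat \<Rightarrow> real" where "x i = 1 - real i" for i
  define L where "L k = (\<Prod>i\<in>{..j}-{k}. smult (1 / (x k - x i)) [:- x i, 1:])" for k
  define I where "I p = (\<Sum>i\<le>j. coeff p i / (real i + 1))" for p :: "real poly"
  have inj: "inj_on x {..j}" by (auto simp: inj_on_def x_def)
  have degL: "degree (L k) \<le> j" if "k \<le> j" for k
  proof -
    have "degree (L k) \<le> sum (degree \<circ> (\<lambda>i. smult (1 / (x k - x i)) [:- x i, 1:])) ({..j}-{k})"
      unfolding L_def by (rule degree_prod_sum_le) simp
    also have "\<dots> \<le> (\<Sum>i\<in>{..j}-{k}. 1)"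
      by (rule sum_mono) (simp add: degree_smult_le)
    also have "\<dots> = j" using that by simp
    finally show ?thesis .
  qed
  have Lval: "poly (L k) (x i) = (if i = k then 1 else 0)" if "k \<le> j" "i \<le> j" for i k
  proof -
    have ne: "x k - x l \<noteq> 0" if "l \<in> {..j}-{k}" for l
      using that by (auto simp: x_def)
    have "poly (L k) (x i) = (\<Prod>l\<in>{..j}-{k}. (x i - x l) / (x k - x l))"
      unfolding L_def poly_prod by (simp add: diff_divide_distrib)
    also have "\<dots> = (if i = k then 1 else 0)"
    proof (cases "i = k")
      case True
      then show ?thesis using ne by (simp add: prod.neutral)
    next
      case False
      then have "i \<in> {..j}-{k}" using that by simp
      then have "(\<Prod>l\<in>{..j}-{k}. (x i - x l) / (x k - x l)) = 0"
        by (intro prod_zero) (auto intro!: bexI[of _ i])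
      then show ?thesis using False by simp
    qed
    finally show ?thesis .
  qed
  have poly_j: "poly p y = (\<Sum>r\<le>j. coeff p r * y ^ r)" if "degree p \<le> j" for p and y :: real
    unfolding poly_altdef by (rule sum.mono_neutral_left) (use that in \<open>auto simp: coeff_eq_0\<close>)
  have sol: "(\<Sum>i\<le>j. poly p (x i) * a i) = I p" if "bary_system j a" "degree p \<le> j" for a p
  proof -
    have "(\<Sum>i\<le>j. poly p (x i) * a i) = (\<Sum>i\<le>j. \<Sum>r\<le>j. coeff p r * (x i ^ r * a i))"
      unfolding poly_j[OF that(2)] sum_distrib_right mult.assoc ..
    also have "\<dots> = (\<Sum>r\<le>j. coeff p r * (\<Sum>i\<le>j. x i ^ r * a i))"
      by (subst sum.swap) (simp add: sum_distrib_left)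
    also have "\<dots> = (\<Sum>r\<le>j. coeff p r * (1 / (real r + 1)))"
      by (rule sum.cong) (use that(1) in \<open>auto simp: bary_system_def x_def\<close>)
    also have "\<dots> = I p" by (simp add: I_def)
    finally show ?thesis .
  qed
  have uniq: "a k = (if k \<le> j then I (L k) else 0)" if "bary_system j a" for a k
  proof (cases "k \<le> j")
    case True
    have "I (L k) = (\<Sum>i\<le>j. poly (L k) (x i) * a i)" using sol[OF that degL[OF True]] by simp
    also have "\<dots> = (\<Sum>i\<le>j. if i = k then a i else 0)"
      by (rule sum.cong) (use True in \<open>auto simp: Lval\<close>)
    also have "\<dots> = a k" using True by (simp add: sum.delta)
    finally show ?thesis using True by simp
  next
    case False then show ?thesis using that by (simp add: bary_system_def)
  qed
  have ex: "bary_system j (\<lambda>k. if k \<le> j then I (L k) else 0)"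
    unfolding bary_system_def
  proof (intro conjI allI impI)
    fix r assume r: "r \<le> j"
    define Q where "Q = (\<Sum>k\<le>j. smult (x k ^ r) (L k))"
    have dQ: "degree (Q - monom 1 r) \<le> j"
      unfolding Q_def using r degL
      by (intro degree_diff_le degree_sum_le)
        (auto simp: degree_monom_eq intro: order_trans[OF degree_smult_le])
    have z: "poly (Q - monom 1 r) (x i) = 0" if i: "i \<le> j" for i
    proof -
      have "poly Q (x i) = (\<Sum>k\<le>j. if i = k then x k ^ r else 0)"
        unfolding Q_def poly_sum by (rule sum.cong) (use i in \<open>auto simp: Lval\<close>)
      also have "\<dots> = x i ^ r" using i by simp
      finally show ?thesis by (simp add: poly_monom)
    qed
    have "Q - monom 1 r = 0"
    proof (rule ccontr)
      assume n: "Q - monom 1 r \<noteq> 0"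
      have "Suc j = card (x ` {..j})" using card_image[OF inj] by simp
      also have "\<dots> \<le> card {y. poly (Q - monom 1 r) y = 0}"
        using z by (intro card_mono poly_roots_finite[OF n]) auto
      also have "\<dots> \<le> degree (Q - monom 1 r)" using card_poly_roots_bound[OF n] .
      finally show False using dQ by simp
    qed
    then have "I Q = I (monom 1 r)" by simp
    also have "\<dots> = (\<Sum>i\<le>j. if r = i then 1 / (real r + 1) else 0)"
      unfolding I_def by (rule sum.cong) auto
    also have "\<dots> = 1 / (real r + 1)" using r by simp
    finally have IQ: "I Q = 1 / (real r + 1)" .
    have "I Q = (\<Sum>k\<le>j. x k ^ r * I (L k))"
      unfolding I_def Q_def coeff_sum
      by (simp add: sum_divide_distrib sum_distrib_left) (rule sum.swap)
    then show "(\<Sum>i\<le>j. (1 - real i) ^ r * (if i \<le> j then I (L i) else 0)) = 1 / (real r + 1)"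
      using IQ by (simp add: x_def)
  qed auto
  show ?thesis
    by (rule ex1I[where P = "bary_system j", OF ex]) (rule ext, rule uniq)
qed

definition bary_phi :: "(real \<Rightarrow> real) \<Rightarrow> nat \<Rightarrow> (real \<Rightarrow> real) \<Rightarrow> real \<Rightarrow> real" where
  "bary_phi f j h x = (\<Sum>i\<le>j. bary_coeff j i * deriv f (x + real i * h x))"

datatype phi_type = Taylor_type | Barycentric_type

primrec phi :: "phi_type \<Rightarrow> (real \<Rightarrow> real) \<Rightarrow> nat \<Rightarrow> (real \<Rightarrow> real) \<Rightarrow> real \<Rightarrow> real" where
  "phi Taylor_type = taylor_phi"
| "phi Barycentric_type = bary_phi"

text \<open>The domain of \<open>phi c f j h\<close> for a step function \<open>h\<close> with domain \<open>H\<close>.\<close>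

primrec phi_dom ::
    "phi_type \<Rightarrow> real set \<Rightarrow> (real \<Rightarrow> real) \<Rightarrow> nat \<Rightarrow> real set \<Rightarrow> (real \<Rightarrow> real) \<Rightarrow> real set" where
  "phi_dom Taylor_type D f j H h = {x \<in> H. \<forall>i\<le>j. x \<in> nderiv_dom D f (i + 1)}"
| "phi_dom Barycentric_type D f j H h = {x \<in> H. \<forall>i\<le>j. x + real i * h x \<in> nderiv_dom D f 1}"

text \<open>
  \<open>t_map \<kappa> f j\<close> is the map \<open>t\<^sub>j\<close>; the type of \<open>\<phi>\<^sub>j\<close> is \<open>\<kappa> j\<close>, chosen independently for each \<open>j\<close>.
  \<open>t_dom \<kappa> D f j\<close> is the set of points at which \<open>t\<^sub>j\<close> is defined.
\<close>

primrec t_map :: "(nat \<Rightarrow> phi_type) \<Rightarrow> (real \<Rightarrow> real) \<Rightarrow> nat \<Rightarrow> real \<Rightarrow> real" where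
  "t_map \<kappa> f 0 = (\<lambda>x. x - inverse (deriv f x) * f x)"
| "t_map \<kappa> f (Suc j) =
     (let h = (\<lambda>x. t_map \<kappa> f j x - x)
      in (\<lambda>x. x - inverse (phi (\<kappa> (Suc j)) f (Suc j) h x) * f x))"

primrec t_dom :: "(nat \<Rightarrow> phi_type) \<Rightarrow> real set \<Rightarrow> (real \<Rightarrow> real) \<Rightarrow> nat \<Rightarrow> real set" where
  "t_dom \<kappa> D f 0 = {x \<in> nderiv_dom D f 1. deriv f x \<noteq> 0}"
| "t_dom \<kappa> D f (Suc j) =
     (let h = (\<lambda>x. t_map \<kappa> f j x - x)
      in {x \<in> phi_dom (\<kappa> (Suc j)) D f (Suc j) (t_dom \<kappa> D f j) h.
            phi (\<kappa> (Suc j)) f (Suc j) h x \<noteq> 0})"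

text \<open>
  Order of convergence at least \<open>q\<close> at \<open>z\<close> of a map \<open>t\<close> with domain \<open>T\<close>. The bound at
  \<open>x = z\<close> contains \<open>t z = z\<close> when \<open>q > 0\<close>.
\<close>

definition convergence_order_ge :: "real set \<Rightarrow> (real \<Rightarrow> real) \<Rightarrow> real \<Rightarrow> nat \<Rightarrow> bool" where
  "convergence_order_ge T t z q \<longleftrightarrow>
     (\<exists>C\<ge>0. \<exists>N. open N \<and> z \<in> N \<and> N \<subseteq> T \<and> (\<forall>x\<in>N. \<bar>t x - z\<bar> \<le> C * \<bar>x - z\<bar> ^ q))"

end

theory Submission
  imports Defs "HOL-Library.Landau_Symbols"
begin

text \<open>
  Either choice of \<open>\<phi>\<close> satisfies \<open>h \<phi> = f (x + h) - f x + O(h\<^bsup>j+2\<^esup>)\<close> and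
  \<open>\<phi> = f' z + O(x - z)\<close>. In the barycentric case the first estimate comes from expanding
  around \<open>x + h\<close>: the linear system for the coefficients turns the combination of the
  \<open>f' (x + i h)\<close> into the Taylor expansion of \<open>f x\<close> at \<open>x + h\<close>. With \<open>t = x + h\<close> and \<open>x - z = (t - z) - h\<close> this gives
  \<open>\<phi> (x - z) - f x = (\<phi> - f' z) (t - z) - (f t - f' z (t - z)) + O(h\<^bsup>j+2\<^esup>)\<close>, which is
  \<open>O((x - z)\<^bsup>j+2\<^esup>)\<close> as soon as \<open>t - z = O((x - z)\<^bsup>j+1\<^esup>)\<close>. Dividing by \<open>\<phi>\<close>,
  which stays away from \<open>0\<close>, shows that each step gains one order. All \<open>O\<close>-estimates are taken
  along \<open>nhds z\<close>, so that they include the point \<open>z\<close> itself.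
\<close>

section \<open>Big-O calculus along a filter\<close>

lemma tendsto_imp_bigo_1:
  fixes f :: "'a \<Rightarrow> real"
  assumes "(f \<longlongrightarrow> c) F"
  shows "f \<in> O[F](\<lambda>_. 1)"
  using assms by (intro bigoI_tendsto[where c = c]) auto

lemma power_bigo_power:
  fixes e :: "'a \<Rightarrow> real"
  assumes "(e \<longlongrightarrow> 0) F" "a \<le> b"
  shows "(\<lambda>x. e x ^ b) \<in> O[F](\<lambda>x. e x ^ a)"
proof -
  have "(\<lambda>x. e x ^ (b - a)) \<in> O[F](\<lambda>_. 1)"
    by (rule tendsto_imp_bigo_1) (rule tendsto_power[OF assms(1)])
  then have "(\<lambda>x. e x ^ a * e x ^ (b - a)) \<in> O[F](\<lambda>x. e x ^ a * 1)"
    by (intro landau_o.big.mult) auto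
  then show ?thesis using assms(2) by (simp flip: power_add)
qed

lemma bigo_imp_tendsto_0:
  fixes f g :: "'a \<Rightarrow> real"
  assumes "f \<in> O[F](g)" "(g \<longlongrightarrow> 0) F"
  shows "(f \<longlongrightarrow> 0) F"
proof -
  obtain c where "\<forall>\<^sub>F x in F. norm (f x) \<le> c * norm (g x)"
    using assms(1) by (rule landau_o.bigE)
  then show ?thesis
    by (rule Lim_null_comparison) (intro tendsto_mult_right_zero tendsto_norm_zero assms(2))
qed

section \<open>Continuity, domains and Taylor expansion of the derivatives near
  \<open>z\<close>\<close>

lemma smooth_near_tendsto:
  assumes "smooth_near D f z"
  shows "((deriv ^^ k) f \<longlongrightarrow> (deriv ^^ k) f z) (nhds z)"
proof -
  have "isCont ((deriv ^^ k) f) z"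
    using assms unfolding smooth_near_def
    by (meson field_differentiable_imp_continuous_at)
  then show ?thesis unfolding isCont_def tendsto_at_iff_tendsto_nhds .
qed

text \<open>One open set \<open>U\<close> serves every order of differentiation. Being open, it
  survives the interior taken at each step of the recursion.\<close>

lemma eventually_mem_nderiv_dom:
  assumes "smooth_near D f z"
  shows "\<forall>\<^sub>F x in nhds z. x \<in> nderiv_dom D f k"
proof -
  obtain U where U: "open U" "z \<in> U" "U \<subseteq> D"
    "\<And>k x. x \<in> U \<Longrightarrow> (deriv ^^ k) f field_differentiable (at x)"
    using assms unfolding smooth_near_def by blast
  have "U \<subseteq> nderiv_dom D f k"
  proof (induction k)
    case (Suc k)
    then have "U \<subseteq> interior (nderiv_dom D f k)" using U(1) by (rule interior_maximal)
    then show ?case using U(4) by auto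
  qed (use U in simp)
  then show ?thesis using U unfolding eventually_nhds by blast
qed

text \<open>Both the base point \<open>u x\<close> and the evaluation point \<open>v x\<close> may
  move, since expansions around x, x + h and z are all needed. The remainder is uniform because the
  derivative of order k + n + 1 is bounded on a compact ball around \<open>z\<close>.\<close>

lemma taylor_bigo:
  fixes u v :: "'a \<Rightarrow> real"
  assumes smooth: "smooth_near D f z"
    and u: "(u \<longlongrightarrow> z) G" and v: "(v \<longlongrightarrow> z) G"
  shows "(\<lambda>x. (deriv ^^ k) f (v x) - (\<Sum>i\<le>n. (deriv ^^ (k + i)) f (u x) * (v x - u x) ^ i / fact i))
    \<in> O[G](\<lambda>x. (v x - u x) ^ Suc n)"
proof -
  obtain U where U: "open U" "z \<in> U"
    "\<And>k x. x \<in> U \<Longrightarrow> (deriv ^^ k) f field_differentiable (at x)"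
    using smooth unfolding smooth_near_def by blast
  obtain d where d: "d > 0" "cball z d \<subseteq> U" using U open_contains_cball by metis
  have der: "((deriv ^^ k) f has_field_derivative (deriv ^^ Suc k) f x) (at x within cball z d)"
    if "x \<in> cball z d" for k x
  proof -
    have "(deriv ^^ k) f field_differentiable (at x)" using U(3) d that by blast
    then show ?thesis
      by (simp add: DERIV_deriv_iff_field_differentiable has_field_derivative_at_within)
  qed
  have "continuous_on (cball z d) ((deriv ^^ (k + Suc n)) f)"
    using U(3) d
    by (intro continuous_at_imp_continuous_on ballI field_differentiable_imp_continuous_at) blast
  then have "bounded ((deriv ^^ (k + Suc n)) f ` cball z d)"
    by (intro compact_imp_bounded compact_continuous_image) auto
  then obtain B where B: "\<And>x. x \<in> cball z d \<Longrightarrow> norm ((deriv ^^ (k + Suc n)) f x) \<le> B"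
    unfolding bounded_iff by blast
  have near: "\<forall>\<^sub>F x in G. w x \<in> cball z d" if "(w \<longlongrightarrow> z) G" for w
    using tendstoD[OF that d(1)] by eventually_elim (simp add: dist_commute)
  show ?thesis
  proof (rule bigoI[of _ "B / fact n"])
    show "\<forall>\<^sub>F x in G. norm ((deriv ^^ k) f (v x) -
        (\<Sum>i\<le>n. (deriv ^^ (k + i)) f (u x) * (v x - u x) ^ i / fact i))
        \<le> B / fact n * norm ((v x - u x) ^ Suc n)"
      using near[OF u] near[OF v]
    proof eventually_elim
      case (elim x)
      \<comment> \<open>The index \<open>k + 0\<close> makes the term the zeroth member of the
        family \<open>\<lambda>i. (deriv ^^ (k + i)) f\<close> to which \<open>field_Taylor\<close>
        is applied; its remainder has the denominator \<open>fact n\<close>.\<close>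
      have "norm ((deriv ^^ (k + 0)) f (v x) -
        (\<Sum>i\<le>n. (deriv ^^ (k + i)) f (u x) * (v x - u x) ^ i / fact i))
        \<le> B * norm (v x - u x) ^ Suc n / fact n"
        using der B elim
        by (intro field_Taylor[where S = "cball z d" and f = "\<lambda>i. (deriv ^^ (k + i)) f"])
          (simp_all only: add_Suc_right convex_cball)
      then show ?case by (simp only: add_0_right norm_power times_divide_eq_left)
    qed
  qed
qed

section \<open>Approximation of f (x + h) - f x by h times phi\<close>

lemma bary_coeff_sum:
  assumes "r \<le> j"
  shows "(\<Sum>i\<le>j. (1 - real i) ^ r * bary_coeff j i) = 1 / (real r + 1)"
  using theI'[OF ex1_bary_system[of j]] assms unfolding bary_coeff_def[symmetric]
  by (simp add: bary_system_def)

lemma taylor_phi_difference: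
  assumes smooth: "smooth_near D f z" and h: "(h \<longlongrightarrow> 0) (nhds z)"
  shows "(\<lambda>x. h x * taylor_phi f j h x - (f (x + h x) - f x)) \<in> O[nhds z](\<lambda>x. h x ^ (j + 2))"
proof -
  have "((\<lambda>x. x + h x) \<longlongrightarrow> z) (nhds z)"
    using tendsto_add[OF filterlim_ident h] by simp
  from taylor_bigo[OF smooth filterlim_ident this, of 0 "Suc j"]
  have "(\<lambda>x. f (x + h x) - (\<Sum>i\<le>Suc j. (deriv ^^ i) f x * h x ^ i / fact i))
      \<in> O[nhds z](\<lambda>x. h x ^ (j + 2))" by simp
  \<comment> \<open>Multiplication by h shifts the index, so h times phi is exactly the Taylor
    polynomial of degree j + 1 at x without its constant term; only the Taylor remainder is
    left.\<close>
  moreover have "(\<Sum>i\<le>Suc j. (deriv ^^ i) f x * h x ^ i / fact i)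
      = f x + h x * taylor_phi f j h x" for x
    unfolding sum.atMost_Suc_shift taylor_phi_def sum_distrib_left
    by (simp add: mult_ac del: fact_Suc)
  ultimately have "(\<lambda>x. - (f (x + h x) - (f x + h x * taylor_phi f j h x)))
      \<in> O[nhds z](\<lambda>x. h x ^ (j + 2))" unfolding landau_o.big.uminus_in_iff by simp
  then show ?thesis by (simp add: algebra_simps)
qed

lemma bary_phi_difference:
  assumes smooth: "smooth_near D f z" and h: "(h \<longlongrightarrow> 0) (nhds z)"
  shows "(\<lambda>x. h x * bary_phi f j h x - (f (x + h x) - f x)) \<in> O[nhds z](\<lambda>x. h x ^ (j + 2))"
proof -
  let ?a = "bary_coeff j"
  define t where "t x = x + h x" for x
  \<comment> \<open>\<open>T i x\<close> is the Taylor polynomial of f' of degree j at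
    \<open>t x\<close>, evaluated at x + i h; \<open>P x\<close> is that of f of degree j + 1,
    evaluated at x = t - h.\<close>
  define T where "T i x = (\<Sum>r\<le>j. (deriv ^^ Suc r) f (t x) * ((real i - 1) * h x) ^ r / fact r)" for i x
  define P where "P x = (\<Sum>i\<le>Suc j. (deriv ^^ i) f (t x) * (- h x) ^ i / fact i)" for x
  have lim: "((\<lambda>x. x + c * h x) \<longlongrightarrow> z) (nhds z)" for c
    using tendsto_add[OF filterlim_ident tendsto_mult_right_zero[OF h]] by simp
  have t: "(t \<longlongrightarrow> z) (nhds z)" using lim[of 1] by (simp add: t_def[abs_def])
  \<comment> \<open>The sign is moved into h so that the factors (1 - i)^r of the linear system
    appear.\<close>
  have pow: "((real i - 1) * h x) ^ r = (- h x) ^ r * (1 - real i) ^ r" for i r x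
  proof -
    have "(real i - 1) * h x = - h x * (1 - real i)" by (simp add: algebra_simps)
    then show ?thesis by (simp only: power_mult_distrib)
  qed
  have "(\<lambda>x. deriv f (x + real i * h x) - T i x) \<in> O[nhds z](\<lambda>x. h x ^ Suc j)" for i
  proof -
    have e: "x + real i * h x - t x = (real i - 1) * h x" for x
      by (simp add: t_def algebra_simps)
    have "(\<lambda>x. deriv f (x + real i * h x) - T i x) \<in> O[nhds z](\<lambda>x. ((real i - 1) * h x) ^ Suc j)"
      using taylor_bigo[OF smooth t lim, of 1 "real i" j] unfolding e T_def by simp
    also have "(\<lambda>x. ((real i - 1) * h x) ^ Suc j) \<in> O[nhds z](\<lambda>x. h x ^ Suc j)"
      by (intro landau_o.big_power) simp
    finally show ?thesis .
  qed
  then have "(\<lambda>x. h x * (\<Sum>i\<le>j. ?a i * (deriv f (x + real i * h x) - T i x)))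
      \<in> O[nhds z](\<lambda>x. h x * h x ^ Suc j)"
    by (intro landau_o.big.mult landau_o.big_refl big_sum_in_bigo) simp
  \<comment> \<open>This is an exact identity: the moment 1/(r+1) turns 1/r! into 1/(r+1)!, as in
    termwise integration of the expansion of f', and h (-h)^r = -(-h)^(r+1) accounts for the
    sign.\<close>
  moreover have "h x * (\<Sum>i\<le>j. ?a i * T i x) = f (t x) - P x" for x
  proof -
    have "(\<Sum>i\<le>j. ?a i * T i x)
        = (\<Sum>i\<le>j. \<Sum>r\<le>j. (deriv ^^ Suc r) f (t x) * (- h x) ^ r / fact r * ((1 - real i) ^ r * ?a i))"
      unfolding T_def sum_distrib_left
      by (intro sum.cong refl) (simp add: pow)
    also have "\<dots> = (\<Sum>r\<le>j. (deriv ^^ Suc r) f (t x) * (- h x) ^ r / fact r * (1 / (real r + 1)))"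
    proof (subst sum.swap, rule sum.cong[OF refl])
      fix r assume "r \<in> {..j}"
      then have a: "1 / (real r + 1) = (\<Sum>i\<le>j. (1 - real i) ^ r * ?a i)"
        by (simp only: bary_coeff_sum atMost_iff)
      show "(\<Sum>i\<le>j. (deriv ^^ Suc r) f (t x) * (- h x) ^ r / fact r * ((1 - real i) ^ r * ?a i))
          = (deriv ^^ Suc r) f (t x) * (- h x) ^ r / fact r * (1 / (real r + 1))"
        unfolding a by (rule sum_distrib_left[symmetric])
    qed
    finally have "h x * (\<Sum>i\<le>j. ?a i * T i x)
        = h x * (\<Sum>r\<le>j. (deriv ^^ Suc r) f (t x) * (- h x) ^ r / fact r * (1 / (real r + 1)))"
      by (rule arg_cong)
    also have "\<dots> = - (\<Sum>r\<le>j. (deriv ^^ Suc r) f (t x) * (- h x) ^ Suc r / fact (Suc r))"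
      unfolding sum_distrib_left sum_negf[symmetric]
      by (intro sum.cong refl) (simp add: field_simps)
    also have "\<dots> = f (t x) - P x"
      unfolding P_def sum.atMost_Suc_shift by (simp del: fact_Suc power_Suc funpow.simps(2))
    finally show ?thesis .
  qed
  ultimately have "(\<lambda>x. h x * bary_phi f j h x - (f (t x) - P x)) \<in> O[nhds z](\<lambda>x. h x ^ (j + 2))"
    by (simp add: right_diff_distrib sum_subtractf bary_phi_def)
  moreover have "(\<lambda>x. f x - P x) \<in> O[nhds z](\<lambda>x. h x ^ (j + 2))"
  proof -
    have "(\<lambda>x. f x - P x) \<in> O[nhds z](\<lambda>x. (- h x) ^ Suc (Suc j))"
      using taylor_bigo[OF smooth t filterlim_ident, of 0 "Suc j"] unfolding P_def
      by (simp add: t_def)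
    also have "(\<lambda>x. (- h x) ^ Suc (Suc j)) \<in> O[nhds z](\<lambda>x. h x ^ Suc (Suc j))"
      by (intro landau_o.big_power) simp
    finally show ?thesis by simp
  qed
  ultimately have "(\<lambda>x. (h x * bary_phi f j h x - (f (t x) - P x)) + (f x - P x))
      \<in> O[nhds z](\<lambda>x. h x ^ (j + 2))" by (rule sum_in_bigo)
  then show ?thesis by (simp add: t_def algebra_simps)
qed

lemma phi_difference:
  assumes "smooth_near D f z" and "(h \<longlongrightarrow> 0) (nhds z)"
  shows "(\<lambda>x. h x * phi c f j h x - (f (x + h x) - f x)) \<in> O[nhds z](\<lambda>x. h x ^ (j + 2))"
  using taylor_phi_difference[OF assms] bary_phi_difference[OF assms] by (cases c) simp_all

section \<open>Closeness of phi to f' z, and its domain\<close>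

lemma deriv_bigo:
  assumes "smooth_near D f z" and "(v \<longlongrightarrow> z) G"
  shows "(\<lambda>x. deriv f (v x) - deriv f z) \<in> O[G](\<lambda>x. v x - z)"
  using taylor_bigo[OF assms(1) tendsto_const assms(2), of 1 0] by simp

lemma phi_bigo:
  assumes smooth: "smooth_near D f z" and h: "h \<in> O[nhds z](\<lambda>x. x - z)"
    and h0: "(h \<longlongrightarrow> 0) (nhds z)"
  shows "(\<lambda>x. phi c f j h x - deriv f z) \<in> O[nhds z](\<lambda>x. x - z)"
proof (cases c)
  case Taylor_type
  have "(\<lambda>x. deriv f x - deriv f z) \<in> O[nhds z](\<lambda>x. x - z)"
    by (rule deriv_bigo[OF smooth filterlim_ident])
  \<comment> \<open>Every summand other than i = 0 carries a bounded coefficient and at least one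
    factor h = O(x - z).\<close>
  moreover have "(\<lambda>x. \<Sum>i\<in>{..j} - {0}. (deriv ^^ (i + 1)) f x / fact (i + 1) * h x ^ i)
      \<in> O[nhds z](\<lambda>x. x - z)"
  proof (rule big_sum_in_bigo)
    fix i assume i: "i \<in> {..j} - {0}"
    have "((deriv ^^ (i + 1)) f \<longlongrightarrow> (deriv ^^ (i + 1)) f z) (nhds z)"
      by (rule smooth_near_tendsto[OF smooth])
    then have "(\<lambda>x. (deriv ^^ (i + 1)) f x / fact (i + 1)) \<in> O[nhds z](\<lambda>_. 1)"
      by (intro tendsto_imp_bigo_1[OF tendsto_divide]) auto
    moreover have "(\<lambda>x. h x ^ i) \<in> O[nhds z](\<lambda>x. x - z)"
      using landau_o.big_trans[OF power_bigo_power[OF h0, of 1 i]] h i by simp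
    ultimately have "(\<lambda>x. (deriv ^^ (i + 1)) f x / fact (i + 1) * h x ^ i)
        \<in> O[nhds z](\<lambda>x. 1 * (x - z))"
      by (rule landau_o.big.mult)
    then show "(\<lambda>x. (deriv ^^ (i + 1)) f x / fact (i + 1) * h x ^ i) \<in> O[nhds z](\<lambda>x. x - z)"
      by (simp only: mult_1)
  qed
  moreover have "taylor_phi f j h x - deriv f z = (deriv f x - deriv f z)
      + (\<Sum>i\<in>{..j} - {0}. (deriv ^^ (i + 1)) f x / fact (i + 1) * h x ^ i)" for x
    unfolding taylor_phi_def by (subst sum.remove[of _ 0]) auto
  ultimately show ?thesis unfolding Taylor_type phi.simps by (simp only: sum_in_bigo(1))
next
  case Barycentric_type
  have "(\<lambda>x. deriv f (x + real i * h x) - deriv f z) \<in> O[nhds z](\<lambda>x. x - z)" for i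
  proof -
    have "((\<lambda>x. x + real i * h x) \<longlongrightarrow> z) (nhds z)"
      using tendsto_add[OF filterlim_ident tendsto_mult_right_zero[OF h0]] by simp
    then have "(\<lambda>x. deriv f (x + real i * h x) - deriv f z) \<in> O[nhds z](\<lambda>x. x + real i * h x - z)"
      by (rule deriv_bigo[OF smooth])
    also have "(\<lambda>x. (x - z) + real i * h x) \<in> O[nhds z](\<lambda>x. x - z)"
      by (rule sum_in_bigo(1)) (use h in auto)
    then have "(\<lambda>x. x + real i * h x - z) \<in> O[nhds z](\<lambda>x. x - z)"
      by (simp add: algebra_simps)
    finally show ?thesis .
  qed
  then have "(\<lambda>x. \<Sum>i\<le>j. bary_coeff j i * (deriv f (x + real i * h x) - deriv f z))
      \<in> O[nhds z](\<lambda>x. x - z)"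
    by (intro big_sum_in_bigo) simp
  \<comment> \<open>The equation for r = 0 says that the coefficients sum to 1, so f' z can be
    distributed over the nodes.\<close>
  moreover have "(\<Sum>i\<le>j. bary_coeff j i * (deriv f (x + real i * h x) - deriv f z))
      = bary_phi f j h x - deriv f z" for x
    using bary_coeff_sum[of 0 j]
    by (simp add: bary_phi_def right_diff_distrib sum_subtractf flip: sum_distrib_right)
  ultimately show ?thesis using Barycentric_type by simp
qed

text \<open>The evaluation points tend to \<open>z\<close> and finitely many conditions are imposed,
  so one neighbourhood meets them all.\<close>

lemma eventually_mem_phi_dom:
  assumes smooth: "smooth_near D f z" and h0: "(h \<longlongrightarrow> 0) (nhds z)"
    and H: "\<forall>\<^sub>F x in nhds z. x \<in> H"
  shows "\<forall>\<^sub>F x in nhds z. x \<in> phi_dom c D f j H h"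
proof (cases c)
  case Taylor_type
  have "\<forall>\<^sub>F x in nhds z. \<forall>i\<in>{..j}. x \<in> nderiv_dom D f (i + 1)"
    by (intro eventually_ball_finite ballI eventually_mem_nderiv_dom[OF smooth]) simp
  with H show ?thesis unfolding Taylor_type by eventually_elim simp
next
  case Barycentric_type
  have "\<forall>\<^sub>F x in nhds z. x + real i * h x \<in> nderiv_dom D f 1" for i
  proof -
    have "((\<lambda>x. x + real i * h x) \<longlongrightarrow> z) (nhds z)"
      using tendsto_add[OF filterlim_ident tendsto_mult_right_zero[OF h0]] by simp
    then show ?thesis
      using eventually_mem_nderiv_dom[OF smooth] by (rule eventually_compose_filterlim[rotated])
  qed
  then have "\<forall>\<^sub>F x in nhds z. \<forall>i\<in>{..j}. x + real i * h x \<in> nderiv_dom D f 1"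
    by (intro eventually_ball_finite ballI) simp_all
  with H show ?thesis unfolding Barycentric_type by eventually_elim simp
qed

section \<open>Gain of one order per step\<close>

lemma quotient_step_bigo:
  fixes z :: real
  assumes p: "(p \<longlongrightarrow> c) (nhds z)" and c: "c \<noteq> 0"
    and g: "(\<lambda>x. p x * (x - z) - f x) \<in> O[nhds z](g)"
  shows "(\<lambda>x. x - inverse (p x) * f x - z) \<in> O[nhds z](g)"
    and "\<forall>\<^sub>F x in nhds z. p x \<noteq> 0"
proof -
  show ne: "\<forall>\<^sub>F x in nhds z. p x \<noteq> 0" by (rule tendsto_imp_eventually_ne[OF p c])
  \<comment> \<open>The error of the quotient step is the residual p (x - z) - f divided by p, and
    1/p is bounded near \<open>z\<close>.\<close>
  have "(\<lambda>x. inverse (p x) * (p x * (x - z) - f x)) \<in> O[nhds z](\<lambda>x. 1 * g x)"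
    by (intro landau_o.big.mult g tendsto_imp_bigo_1[OF tendsto_inverse[OF p c]])
  moreover have "\<forall>\<^sub>F x in nhds z. inverse (p x) * (p x * (x - z) - f x)
      = x - inverse (p x) * f x - z"
    using ne by eventually_elim (simp add: field_simps)
  ultimately show "(\<lambda>x. x - inverse (p x) * f x - z) \<in> O[nhds z](g)"
    by (simp add: landau_o.big.in_cong)
qed

lemma phi_residual_bigo:
  assumes smooth: "smooth_near D f z" and fz: "f z = 0"
    and t: "(\<lambda>x. t x - z) \<in> O[nhds z](\<lambda>x. (x - z) ^ (j + 1))" and j: "j \<ge> 1"
    and h0: "(h \<longlongrightarrow> 0) (nhds z)" and h: "h \<in> O[nhds z](\<lambda>x. x - z)"
    and t_def: "\<And>x. t x = x + h x"
  shows "(\<lambda>x. phi c f j h x * (x - z) - f x) \<in> O[nhds z](\<lambda>x. (x - z) ^ (j + 2))"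
    (is "_ \<in> ?O")
proof -
  let ?p = "phi c f j h"
  have xz: "((\<lambda>x. x - z) \<longlongrightarrow> 0) (nhds z)"
    using tendsto_diff[OF filterlim_ident tendsto_const, of z z] by simp
  have tz: "(t \<longlongrightarrow> z) (nhds z)"
    using tendsto_add[OF filterlim_ident h0] by (simp add: t_def[abs_def])
  have "(\<lambda>x. (?p x - deriv f z) * (t x - z)) \<in> O[nhds z](\<lambda>x. (x - z) * (x - z) ^ (j + 1))"
    by (intro landau_o.big.mult phi_bigo[OF smooth h h0] t)
  then have 1: "(\<lambda>x. (?p x - deriv f z) * (t x - z)) \<in> ?O" by simp
  \<comment> \<open>Expansion at the fixed point \<open>z\<close>, where f vanishes, leaves a
    quadratic error; its order 2(j + 1) is at least j + 2.\<close>
  have "(\<lambda>x. f (t x) - deriv f z * (t x - z)) \<in> O[nhds z](\<lambda>x. (t x - z) ^ 2)"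
    using taylor_bigo[OF smooth tendsto_const tz, of 0 1] fz by (simp add: numeral_2_eq_2)
  also have "(\<lambda>x. (t x - z) ^ 2) \<in> O[nhds z](\<lambda>x. ((x - z) ^ (j + 1)) ^ 2)"
    by (rule landau_o.big_power[OF t])
  also have "(\<lambda>x. ((x - z) ^ (j + 1)) ^ 2) \<in> ?O"
    using power_bigo_power[OF xz, of "j + 2" "(j + 1) * 2"] j unfolding power_mult by simp
  finally have 2: "(\<lambda>x. f (t x) - deriv f z * (t x - z)) \<in> ?O" .
  have 3: "(\<lambda>x. h x * ?p x - (f (t x) - f x)) \<in> ?O"
    unfolding t_def
    by (rule landau_o.big_trans[OF phi_difference[OF smooth h0] landau_o.big_power[OF h]])
  have "(\<lambda>x. (?p x - deriv f z) * (t x - z) - (f (t x) - deriv f z * (t x - z))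
      - (h x * ?p x - (f (t x) - f x))) \<in> ?O"
    by (intro sum_in_bigo 1 2 3)
  moreover have "(?p x - deriv f z) * (t x - z) - (f (t x) - deriv f z * (t x - z))
      - (h x * ?p x - (f (t x) - f x)) = ?p x * (x - z) - f x" for x
    by (simp add: t_def[of x] algebra_simps)
  ultimately show ?thesis by simp
qed

text \<open>Estimate and domain share one induction: the estimate for index j yields h -> 0, which
  places the evaluation points of the next phi in their domain.\<close>

lemma t_map_bigo:
  assumes smooth: "smooth_near D f z" and fz: "f z = 0" and f'z: "deriv f z \<noteq> 0"
  shows "(\<lambda>x. t_map \<kappa> f j x - z) \<in> O[nhds z](\<lambda>x. (x - z) ^ (j + 2)) \<and>
    (\<forall>\<^sub>F x in nhds z. x \<in> t_dom \<kappa> D f j)"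
proof (induction j)
  case 0
  have p: "(deriv f \<longlongrightarrow> deriv f z) (nhds z)"
    using smooth_near_tendsto[OF smooth, of 1] by simp
  \<comment> \<open>Newton's residual is the first-order Taylor remainder for base point x and
    evaluation point \<open>z\<close>, because f z = 0.\<close>
  have "(\<lambda>x. (deriv f x * (x - z) - f x)) \<in> O[nhds z](\<lambda>x. (z - x) ^ 2)"
    using taylor_bigo[OF smooth filterlim_ident tendsto_const, of 0 1] fz
    by (simp add: numeral_2_eq_2 algebra_simps)
  then have g: "(\<lambda>x. (deriv f x * (x - z) - f x)) \<in> O[nhds z](\<lambda>x. (x - z) ^ 2)"
    by (simp add: power2_commute)
  have "\<forall>\<^sub>F x in nhds z. x \<in> t_dom \<kappa> D f 0"
    using quotient_step_bigo(2)[OF p f'z g] eventually_mem_nderiv_dom[OF smooth, of 1]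
    by eventually_elim simp
  with quotient_step_bigo(1)[OF p f'z g] show ?case by (simp only: t_map.simps add_0 simp_thms)
next
  case (Suc j)
  let ?t = "t_map \<kappa> f j"
  define h where "h x = ?t x - x" for x
  let ?p = "phi (\<kappa> (Suc j)) f (Suc j) h"
  have xz: "((\<lambda>x. x - z) \<longlongrightarrow> 0) (nhds z)"
    using tendsto_diff[OF filterlim_ident tendsto_const, of z z] by simp
  \<comment> \<open>The order j + 2 of the induction hypothesis is rewritten as
    \<open>Suc j + 1\<close>, the form required for a phi of index \<open>Suc j\<close>.\<close>
  have t: "(\<lambda>x. ?t x - z) \<in> O[nhds z](\<lambda>x. (x - z) ^ (Suc j + 1))" using Suc.IH by simp
  have "(\<lambda>x. ?t x - z) \<in> O[nhds z](\<lambda>x. x - z)"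
    using landau_o.big_trans[OF t power_bigo_power[OF xz, of 1]] by simp
  from sum_in_bigo(2)[OF this landau_o.big_refl]
  have h: "h \<in> O[nhds z](\<lambda>x. x - z)" by (simp add: h_def[abs_def])
  have h0: "(h \<longlongrightarrow> 0) (nhds z)" by (rule bigo_imp_tendsto_0[OF h xz])
  have "(\<lambda>x. ?p x - deriv f z) \<in> O[nhds z](\<lambda>x. x - z)" by (rule phi_bigo[OF smooth h h0])
  then have "((\<lambda>x. ?p x - deriv f z) \<longlongrightarrow> 0) (nhds z)" by (rule bigo_imp_tendsto_0[OF _ xz])
  then have p: "(?p \<longlongrightarrow> deriv f z) (nhds z)" by (rule LIM_zero_cancel)
  have g: "(\<lambda>x. ?p x * (x - z) - f x) \<in> O[nhds z](\<lambda>x. (x - z) ^ (Suc j + 2))"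
    by (rule phi_residual_bigo[OF smooth fz t _ h0 h]) (simp_all add: h_def)
  have "\<forall>\<^sub>F x in nhds z. x \<in> phi_dom (\<kappa> (Suc j)) D f (Suc j) (t_dom \<kappa> D f j) h"
    using Suc.IH by (intro eventually_mem_phi_dom[OF smooth h0]) simp
  with quotient_step_bigo(2)[OF p f'z g]
  have "\<forall>\<^sub>F x in nhds z. x \<in> t_dom \<kappa> D f (Suc j)"
    by eventually_elim (simp add: Let_def h_def[abs_def])
  with quotient_step_bigo(1)[OF p f'z g] show ?case
    by (simp only: t_map.simps Let_def h_def[abs_def] simp_thms)
qed

theorem proposition3p1:
  fixes D :: "real set" and f :: "real \<Rightarrow> real" and z :: real
    and m :: nat and \<kappa> :: "nat \<Rightarrow> phi_type"
  assumes "open D" and "z \<in> D"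
    and "smooth_near D f z"
    and "f z = 0" and "deriv f z \<noteq> 0"
    and "m \<ge> 1"
  shows "convergence_order_ge (t_dom \<kappa> D f m) (t_map \<kappa> f m) z (m + 2)"
proof -
  have t: "(\<lambda>x. t_map \<kappa> f m x - z) \<in> O[nhds z](\<lambda>x. (x - z) ^ (m + 2))"
    and dom: "\<forall>\<^sub>F x in nhds z. x \<in> t_dom \<kappa> D f m"
    using t_map_bigo[OF assms(3-5)] by auto
  from t obtain C where C: "C > 0"
    "\<forall>\<^sub>F x in nhds z. \<bar>t_map \<kappa> f m x - z\<bar> \<le> C * \<bar>x - z\<bar> ^ (m + 2)"
    by (rule landau_o.bigE) (simp only: real_norm_def power_abs)
  \<comment> \<open>The bound and the domain must hold on the same open set, so they are merged
    before \<open>N\<close> is chosen.\<close>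
  from eventually_conj[OF dom C(2)] obtain N where "open N" "z \<in> N"
    "\<forall>x\<in>N. x \<in> t_dom \<kappa> D f m \<and> \<bar>t_map \<kappa> f m x - z\<bar> \<le> C * \<bar>x - z\<bar> ^ (m + 2)"
    unfolding eventually_nhds by blast
  with C(1) show ?thesis
    unfolding convergence_order_ge_def
    by (intro exI[of _ C] conjI exI[of _ N]) auto
qed

end
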